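(* Let $E=TE^4_2$ be the tangent bundle of $E^4_2$, $h$ the metric of $E^4_2$ and $\nabla$ the Levi-Civita connection of $h$. Let $e=(e_1,e_2,e_3,e_4)$ be an ordered pseudo-orthonormal frame field of $TE^4_2$ giving the orientation, let $\omega=[\omega^i_j]$ be the connection form of $\nabla$ with respect to $e$ ($\nabla e=e\omega$), and let $\varepsilon\in\{+,-\}$. The following two conditions are equivalent: (a) the covariant derivative $\hat\nabla\Omega_{\varepsilon,2}$ is fully light-like; (b) there are functions $f^\varepsilon,g^\varepsilon$ on $E^4_2$ with $dg^\varepsilon\neq0$ (at every point) and $\mu\in\{+,-\}$ such that $$\omega^4_1=\varepsilon e^{\mu f^\varepsilon}dg^\varepsilon-\varepsilon\omega^3_2,\qquad \omega^4_2=\varepsilon\omega^3_1-df^\varepsilon,\qquad \omega^4_3=\mu e^{\mu f^\varepsilon}dg^\varepsilon-\varepsilon\omega^2_1$$ and $$d\omega^2_1=2\omega^3_1\wedge\omega^3_2-e^{\mu f^\varepsilon}\omega^3_1\wedge dg^\varepsilon+\varepsilon\omega^3_2\wedge df^\varepsilon+\varepsilon e^{\mu f^\varepsilon}df^\varepsilon\wedge dg^\varepsilon,$$ $$d\omega^3_1=2\omega^2_1\wedge\omega^3_2-e^{\mu f^\varepsilon}\omega^2_1\wedge dg^\varepsilon+\varepsilon\mu e^{\mu f^\varepsilon}\omega^3_2\wedge dg^\varepsilon,$$ $$d\omega^3_2=-2\omega^2_1\wedge\omega^3_1+\varepsilon\omega^2_1\wedge df^\varepsilon-\varepsilon\mu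 e^{\mu f^\varepsilon}\omega^3_1\wedge dg^\varepsilon+\mu e^{\mu f^\varepsilon}df^\varepsilon\wedge dg^\varepsilon.$$ In addition, if one of (a), (b) holds, then $\hat\nabla\Omega_{\varepsilon,2}=\alpha\otimes\Omega_0$, where $$\alpha:=e^{\mu f^\varepsilon}dg^\varepsilon,\qquad \Omega_0:=\Omega_{-\varepsilon,1}+\mu\,\Omega_{\varepsilon,3}$$ (with $f^\varepsilon,g^\varepsilon,\mu$ as in (b)), and $\Omega_0$ can be horizontal for a suitable frame field, i.e. there is an ordered pseudo-orthonormal frame field $e'$ of $TE^4_2$ giving the orientation, with the same $\Omega_{\varepsilon,2}$, such that the section $\Omega_0$ defined from $e'$ satisfies $\hat\nabla\Omega_0=0$.
   Context: $E^4_2$ is the oriented space $\mathbf R^4$ with the flat metric of signature $(2,2)$. Signs $\varepsilon,\mu\in\{+,-\}$ are identified with $\pm1$. An ordered pseudo-orthonormal frame field $(e_1,e_2,e_3,e_4)$ has $e_1,e_2$ space-like ($h(e_i,e_i)=1$) and $e_3,e_4$ time-like ($h(e_i,e_i)=-1$). $\hat h$ and $\hat\nabla$ are the metric and connection of $\bigwedge^2E$ induced by $h$ and $\nabla$. For such a frame, $$\Omega_{\pm,1}:=\tfrac1{\sqrt2}(e_1\wedge e_2\pm e_3\wedge e_4),\ \ \Omega_{\pm,2}:=\tfrac1{\sqrt2}(e_1\wedge e_3\pm e_4\wedge e_2),\ \ \Omega_{\pm,3}:=\tfrac1{\sqrt2}(e_1\wedge e_4\pm e_2\wedge e_3).$$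 $\Omega_{\varepsilon,2}$ is a section of the time-like twistor space $\{\theta\in\bigwedge^2_\varepsilon E:\hat h(\theta,\theta)=-1\}$, where $\bigwedge^2_\varepsilon E$ is the rank-$3$ subbundle of $\bigwedge^2E$ spanned by $\Omega_{-\varepsilon,1},\Omega_{\varepsilon,2},\Omega_{\varepsilon,3}$ for positively oriented frames. For a section $\Omega$ of this twistor space, $\hat\nabla\Omega$ is fully light-like if at each point $p$, $\hat\nabla_v\Omega$ is light-like or zero with respect to $\hat h$ for every tangent vector $v$ at $p$, and is nonzero for some $v$ (so $\hat\nabla\Omega$ determines a light-like line at each point). *)

theory Defs
  imports "HOL-Analysis.Analysis"
begin

(* The oriented space R^4 with the flat metric x1 y1 + x2 y2 - x3 y3 - x4 y4.  All bundles over
   it are trivialised by the global coordinates, so sections are functions on real^4.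
   In the index type 4 the numeral 4 denotes the same element as 0. *)

definition sig :: "4 \<Rightarrow> real" where
  "sig i = (if i = 1 \<or> i = 2 then 1 else - 1)"

definition h :: "real^4 \<Rightarrow> real^4 \<Rightarrow> real" where
  "h x y = (\<Sum>i\<in>UNIV. sig i * x $ i * y $ i)"

(* Bivectors are realised as skew-symmetric matrices. *)

type_synonym bivector = "real^4^4"

definition bwedge :: "real^4 \<Rightarrow> real^4 \<Rightarrow> bivector" where
  "bwedge x y = (\<chi> i j. x $ i * y $ j - x $ j * y $ i)"

(* The factor 1/2 accounts for each pair i < j being counted twice; see hhat_bwedge. *)

definition hhat :: "bivector \<Rightarrow> bivector \<Rightarrow> real" where
  "hhat A B = (\<Sum>i\<in>UNIV. \<Sum>j\<in>UNIV. sig i * sig j * A $ i $ j * B $ i $ j) / 2"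

lemma hhat_bwedge:
  "hhat (bwedge x y) (bwedge z w) = h x z * h y w - h x w * h y z"
  by (simp add: hhat_def bwedge_def h_def sig_def sum_4 field_simps)

(* C^k on the whole of real^4: by finite-dimensionality it suffices to ask that f is
   differentiable and that all its directional derivatives are C^(k-1). *)

primrec Ck :: "nat \<Rightarrow> (real^4 \<Rightarrow> 'b::real_normed_vector) \<Rightarrow> bool" where
  "Ck 0 f \<longleftrightarrow> continuous_on UNIV f"
| "Ck (Suc k) f \<longleftrightarrow> (\<forall>p. f differentiable (at p)) \<and>
     (\<forall>v. Ck k (\<lambda>p. frechet_derivative f (at p) v))"

definition smooth :: "(real^4 \<Rightarrow> 'b::real_normed_vector) \<Rightarrow> bool" where
  "smooth f \<longleftrightarrow> (\<forall>k. Ck k f)"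

(* The metric h has constant coefficients, so the Christoffel symbols of its Levi-Civita
   connection in the standard coordinates vanish: nabla X p v is the derivative of the components
   of X at p in the direction v.  At type bivector the same formula is the connection induced on
   the second exterior power; see nabla_bwedge. *)

definition nabla :: "(real^4 \<Rightarrow> 'b::real_normed_vector) \<Rightarrow> real^4 \<Rightarrow> real^4 \<Rightarrow> 'b" where
  "nabla X p v = frechet_derivative X (at p) v"

lemma bilinear_bwedge: "bounded_bilinear bwedge"
  unfolding bilinear_conv_bounded_bilinear [symmetric] bilinear_def linear_iff
  by (auto simp: bwedge_def vec_eq_iff algebra_simps)

lemma bilinear_h: "bounded_bilinear h"
  unfolding bilinear_conv_bounded_bilinear [symmetric] bilinear_def linear_iff
  by (auto simp: h_def sum_4 algebra_simps)

lemma nabla_bwedge: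
  assumes "X differentiable (at p)" "Y differentiable (at p)"
  shows "nabla (\<lambda>q. bwedge (X q) (Y q)) p v
    = bwedge (nabla X p v) (Y p) + bwedge (X p) (nabla Y p v)"
proof -
  have "((\<lambda>q. bwedge (X q) (Y q)) has_derivative
      (\<lambda>v. bwedge (X p) (frechet_derivative Y (at p) v)
         + bwedge (frechet_derivative X (at p) v) (Y p))) (at p)"
    using assms unfolding frechet_derivative_works
    by (rule bounded_bilinear.FDERIV [OF bilinear_bwedge])
  from frechet_derivative_at [OF this, symmetric] show ?thesis
    by (simp add: nabla_def)
qed

lemma nabla_metric:
  assumes "X differentiable (at p)" "Y differentiable (at p)"
  shows "frechet_derivative (\<lambda>q. h (X q) (Y q)) (at p) v
    = h (nabla X p v) (Y p) + h (X p) (nabla Y p v)"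
proof -
  have "((\<lambda>q. h (X q) (Y q)) has_derivative
      (\<lambda>v. h (X p) (frechet_derivative Y (at p) v)
         + h (frechet_derivative X (at p) v) (Y p))) (at p)"
    using assms unfolding frechet_derivative_works
    by (rule bounded_bilinear.FDERIV [OF bilinear_h])
  from frechet_derivative_at [OF this, symmetric] show ?thesis
    by (simp add: nabla_def)
qed

type_synonym frame = "4 \<Rightarrow> real^4 \<Rightarrow> real^4"

definition oriented_frame_field :: "frame \<Rightarrow> bool" where
  "oriented_frame_field e \<longleftrightarrow>
     (\<forall>i. smooth (e i)) \<and>
     (\<forall>p i j. h (e i p) (e j p) = (if i = j then sig i else 0)) \<and>
     (\<forall>p. det (\<chi> i j. e j p $ i) > 0)"

(* A 1-form takes a point and a tangent vector, a 2-form a point and two tangent vectors. *)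

type_synonym form1 = "real^4 \<Rightarrow> real^4 \<Rightarrow> real"
type_synonym form2 = "real^4 \<Rightarrow> real^4 \<Rightarrow> real^4 \<Rightarrow> real"

definition d0 :: "(real^4 \<Rightarrow> real) \<Rightarrow> form1" where
  "d0 f p v = frechet_derivative f (at p) v"

definition d1 :: "form1 \<Rightarrow> form2" where
  "d1 a p v w = frechet_derivative (\<lambda>q. a q w) (at p) v - frechet_derivative (\<lambda>q. a q v) (at p) w"

definition fwedge :: "form1 \<Rightarrow> form1 \<Rightarrow> form2" where
  "fwedge a b p v w = a p v * b p w - a p w * b p v"

(* nabla e = e omega, where omega i j is the entry with upper index i and lower index j. *)

definition connection_form :: "frame \<Rightarrow> (4 \<Rightarrow> 4 \<Rightarrow> form1) \<Rightarrow> bool" where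
  "connection_form e \<omega> \<longleftrightarrow>
     (\<forall>j p v. nabla (e j) p v = (\<Sum>i\<in>UNIV. \<omega> i j p v *\<^sub>R e i p))"

definition Omega1 :: "real \<Rightarrow> frame \<Rightarrow> real^4 \<Rightarrow> bivector" where
  "Omega1 s e p = (1 / sqrt 2) *\<^sub>R (bwedge (e 1 p) (e 2 p) + s *\<^sub>R bwedge (e 3 p) (e 4 p))"

definition Omega2 :: "real \<Rightarrow> frame \<Rightarrow> real^4 \<Rightarrow> bivector" where
  "Omega2 s e p = (1 / sqrt 2) *\<^sub>R (bwedge (e 1 p) (e 3 p) + s *\<^sub>R bwedge (e 4 p) (e 2 p))"

definition Omega3 :: "real \<Rightarrow> frame \<Rightarrow> real^4 \<Rightarrow> bivector" where
  "Omega3 s e p = (1 / sqrt 2) *\<^sub>R (bwedge (e 1 p) (e 4 p) + s *\<^sub>R bwedge (e 2 p) (e 3 p))"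

definition Omega0 :: "real \<Rightarrow> real \<Rightarrow> frame \<Rightarrow> real^4 \<Rightarrow> bivector" where
  "Omega0 \<epsilon> \<mu> e p = Omega1 (- \<epsilon>) e p + \<mu> *\<^sub>R Omega3 \<epsilon> e p"

definition light_like :: "bivector \<Rightarrow> bool" where
  "light_like A \<longleftrightarrow> A \<noteq> 0 \<and> hhat A A = 0"

definition fully_light_like :: "(real^4 \<Rightarrow> bivector) \<Rightarrow> bool" where
  "fully_light_like \<Omega> \<longleftrightarrow>
     (\<forall>p. (\<forall>v. light_like (nabla \<Omega> p v) \<or> nabla \<Omega> p v = 0) \<and> (\<exists>v. nabla \<Omega> p v \<noteq> 0))"

definition alpha :: "real \<Rightarrow> (real^4 \<Rightarrow> real) \<Rightarrow> (real^4 \<Rightarrow> real) \<Rightarrow> form1" where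
  "alpha \<mu> f g p v = exp (\<mu> * f p) * d0 g p v"

definition condition_b ::
  "real \<Rightarrow> (4 \<Rightarrow> 4 \<Rightarrow> form1) \<Rightarrow> (real^4 \<Rightarrow> real) \<Rightarrow> (real^4 \<Rightarrow> real) \<Rightarrow> real \<Rightarrow> bool" where
  "condition_b \<epsilon> \<omega> f g \<mu> \<longleftrightarrow>
     smooth f \<and> smooth g \<and> (\<forall>p. \<exists>v. d0 g p v \<noteq> 0) \<and> \<mu> \<in> {1, - 1} \<and>
     (\<forall>p v. \<omega> 4 1 p v = \<epsilon> * exp (\<mu> * f p) * d0 g p v - \<epsilon> * \<omega> 3 2 p v) \<and>
     (\<forall>p v. \<omega> 4 2 p v = \<epsilon> * \<omega> 3 1 p v - d0 f p v) \<and>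
     (\<forall>p v. \<omega> 4 3 p v = \<mu> * exp (\<mu> * f p) * d0 g p v - \<epsilon> * \<omega> 2 1 p v) \<and>
     (\<forall>p v w. d1 (\<omega> 2 1) p v w =
        2 * fwedge (\<omega> 3 1) (\<omega> 3 2) p v w
        - exp (\<mu> * f p) * fwedge (\<omega> 3 1) (d0 g) p v w
        + \<epsilon> * fwedge (\<omega> 3 2) (d0 f) p v w
        + \<epsilon> * exp (\<mu> * f p) * fwedge (d0 f) (d0 g) p v w) \<and>
     (\<forall>p v w. d1 (\<omega> 3 1) p v w =
        2 * fwedge (\<omega> 2 1) (\<omega> 3 2) p v w
        - exp (\<mu> * f p) * fwedge (\<omega> 2 1) (d0 g) p v w
        + \<epsilon> * \<mu> * exp (\<mu> * f p) * fwedge (\<omega> 3 2) (d0 g) p v w) \<and>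
     (\<forall>p v w. d1 (\<omega> 3 2) p v w =
        - 2 * fwedge (\<omega> 2 1) (\<omega> 3 1) p v w
        + \<epsilon> * fwedge (\<omega> 2 1) (d0 f) p v w
        - \<epsilon> * \<mu> * exp (\<mu> * f p) * fwedge (\<omega> 3 1) (d0 g) p v w
        + \<mu> * exp (\<mu> * f p) * fwedge (d0 f) (d0 g) p v w)"

end

(* With Om1 = Omega1 (-eps) e, Om2 = Omega2 eps e, Om3 = Omega3 eps e and the forms
     a = w32 + eps w41,  b = w43 + eps w21,  c = eps w31 - w42
   one has nabla Om2 = a Om1 + b Om3, nabla Om1 = a Om2 - c Om3, nabla Om3 = -c Om1 - b Om2.
   As Om1 is space-like and Om3 time-like of opposite length, nabla Om2 is fully light-like iff
   a vanishes nowhere and b = mu a, where the sign mu is constant because R^4 is connected.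
   Flatness then gives dc = 0 and da = mu c /\ a, so by the Poincare lemma c = df and
   exp (-mu f) a = dg; the remaining equations of (b) are the structure equations dw = -w /\ w.
   Finally nabla Om0 = -mu df Om0, and the boost with parameter f in the plane of e2, e4 fixes Om2
   and multiplies Om0 = Om1 + mu Om3 by exp (mu f), which makes it parallel. *)

theory Submission
  imports Defs
begin

section \<open>Smooth functions\<close>

lemma Ck_SucD: "Ck (Suc k) f \<Longrightarrow> Ck k f"
proof (induction k arbitrary: f)
  case 0
  then show ?case
    by (simp add: continuous_on_eq_continuous_within differentiable_imp_continuous_within)
next
  case (Suc k)
  then show ?case by (metis Ck.simps(2))
qed

lemma frechet_derivative_eqI:
  "(f has_derivative f') (at p) \<Longrightarrow> frechet_derivative f (at p) = f'"
  by (metis frechet_derivative_at)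

lemma Ck_add: "Ck k f \<Longrightarrow> Ck k g \<Longrightarrow> Ck k (\<lambda>p. f p + g p)"
proof (induction k arbitrary: f g)
  case 0
  then show ?case by (simp add: continuous_on_add)
next
  case (Suc k)
  have "frechet_derivative (\<lambda>p. f p + g p) (at p)
      = (\<lambda>v. frechet_derivative f (at p) v + frechet_derivative g (at p) v)" for p
    using Suc.prems by (intro frechet_derivative_eqI has_derivative_add)
      (auto simp: frechet_derivative_works)
  with Suc show ?case by (auto intro: differentiable_add)
qed

lemma Ck_const: "Ck k (\<lambda>p. c)"
  by (induction k arbitrary: c) auto

text \<open>The derivative of a product is a sum of two products, each with one factor left
  undifferentiated. \<open>Ck_SucD\<close> lowers the order of that factor, so that the induction
  hypothesis applies to both.\<close>

lemma (in bounded_bilinear) Ck_prod: "Ck k f \<Longrightarrow> Ck k g \<Longrightarrow> Ck k (\<lambda>p. prod (f p) (g p))"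
proof (induction k arbitrary: f g)
  case 0
  then show ?case by (simp add: continuous_on)
next
  case (Suc k)
  have D: "((\<lambda>p. prod (f p) (g p)) has_derivative
        (\<lambda>v. prod (f p) (frechet_derivative g (at p) v) + prod (frechet_derivative f (at p) v) (g p))) (at p)" for p
    using Suc.prems by (intro FDERIV) (auto simp: frechet_derivative_works)
  show ?case
    using Suc D Ck_SucD[OF Suc.prems(1)] Ck_SucD[OF Suc.prems(2)]
    by (auto simp: frechet_derivative_eqI[OF D] differentiable_def intro!: Ck_add) 
qed

lemma Ck_exp:
  fixes f :: "real^4 \<Rightarrow> real"
  shows "Ck k f \<Longrightarrow> Ck k (\<lambda>p. exp (f p))"
proof (induction k arbitrary: f)
  case 0
  then show ?case by (simp add: continuous_on_exp)
next
  case (Suc k)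
  have D: "((\<lambda>p. exp (f p)) has_derivative (\<lambda>v. exp (f p) * frechet_derivative f (at p) v)) (at p)" for p
    using Suc.prems
    by (auto intro!: derivative_eq_intros simp: frechet_derivative_works[symmetric])
  show ?case
    using Suc D Ck_SucD[OF Suc.prems]
    by (auto simp: frechet_derivative_eqI[OF D] differentiable_def
        intro!: bounded_bilinear.Ck_prod[OF bounded_bilinear_mult])
qed

text \<open>Removes the order k from all later arguments: derivatives of smooth functions are again
  smooth, without any loss to keep track of.\<close>

lemma smooth_iff:
  "smooth f \<longleftrightarrow> (\<forall>p. f differentiable (at p)) \<and> (\<forall>v. smooth (\<lambda>p. frechet_derivative f (at p) v))"
  unfolding smooth_def by (metis Ck.simps(2) Ck_SucD)

lemma smooth_differentiable: "smooth f \<Longrightarrow> f differentiable (at p)"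
  using smooth_iff by blast

lemma smooth_has_derivative: "smooth f \<Longrightarrow> (f has_derivative frechet_derivative f (at p)) (at p)"
  using smooth_differentiable frechet_derivative_works by blast

lemma smooth_frechet_derivative: "smooth f \<Longrightarrow> smooth (\<lambda>p. frechet_derivative f (at p) v)"
  using smooth_iff by blast

lemma smooth_continuous_on: "smooth f \<Longrightarrow> continuous_on S f"
  by (metis Ck.simps(1) continuous_on_subset smooth_def top_greatest)

lemma smooth_const: "smooth (\<lambda>p. c)"
  by (simp add: smooth_def Ck_const)

lemma smooth_add: "smooth f \<Longrightarrow> smooth g \<Longrightarrow> smooth (\<lambda>p. f p + g p)"
  by (simp add: smooth_def Ck_add)

lemma (in bounded_bilinear) smooth_prod: "smooth f \<Longrightarrow> smooth g \<Longrightarrow> smooth (\<lambda>p. prod (f p) (g p))"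
  by (simp add: smooth_def Ck_prod)

lemmas smooth_mult = bounded_bilinear.smooth_prod[OF bounded_bilinear_mult]
lemmas smooth_scaleR = bounded_bilinear.smooth_prod[OF bounded_bilinear_scaleR]
lemmas smooth_h = bounded_bilinear.smooth_prod[OF bilinear_h]

lemma smooth_exp: "smooth f \<Longrightarrow> smooth (\<lambda>p. exp (f p :: real))"
  by (simp add: smooth_def Ck_exp)

lemma smooth_minus: "smooth f \<Longrightarrow> smooth (\<lambda>p. - f p)"
  using smooth_scaleR[OF smooth_const[of "-1"]] by simp

lemma smooth_diff: "smooth f \<Longrightarrow> smooth g \<Longrightarrow> smooth (\<lambda>p. f p - g p)"
  using smooth_add smooth_minus by fastforce

lemmas smooth_intros = smooth_const smooth_add smooth_mult smooth_scaleR smooth_h smooth_exp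
  smooth_minus smooth_diff smooth_frechet_derivative

text \<open>The chain rule along straight lines, which brings the fundamental theorem of calculus on
  an interval to bear on functions on \<open>real^4\<close>.\<close>

lemma smooth_has_vector_derivative_line:
  assumes "smooth f"
  shows "((\<lambda>s. f (p + s *\<^sub>R v)) has_vector_derivative frechet_derivative f (at (p + s *\<^sub>R v)) v) (at s within S)"
proof -
  have "((\<lambda>s. f (p + s *\<^sub>R v)) has_derivative (\<lambda>s'. frechet_derivative f (at (p + s *\<^sub>R v)) (s' *\<^sub>R v))) (at s within S)"
    by (rule has_derivative_compose[OF _ smooth_has_derivative[OF assms]])
      (auto intro!: derivative_eq_intros)
  then show ?thesis
    using linear_frechet_derivative[OF smooth_differentiable[OF assms]]
    by (simp add: has_vector_derivative_def linear_scale)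
qed

text \<open>Schwarz's theorem. It expresses the flatness of \<open>nabla\<close> and enters
  \<open>structure_equation\<close> in this role.\<close>

lemma frechet_derivative_commute:
  fixes f :: "real^4 \<Rightarrow> 'b::banach"
  assumes f: "smooth f"
  shows "frechet_derivative (\<lambda>q. frechet_derivative f (at q) w) (at p) v
    = frechet_derivative (\<lambda>q. frechet_derivative f (at q) v) (at p) w"
proof -
  define a where "a = (\<lambda>q. frechet_derivative f (at q) v)"
  define b where "b = (\<lambda>q. frechet_derivative f (at q) w)"
  define c where "c = (\<lambda>q. frechet_derivative a (at q) w)"
  have sm: "smooth a" "smooth b" "smooth c"
    unfolding a_def b_def c_def by (intro smooth_intros f)+
  \<comment> \<open>Both sides are the rate of change at t = 0 of the w-derivative of f(p + tv) - f(p), computed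
    once directly and once under the integral of the v-derivative along the segment.\<close>
  have ftc: "integral {0..t} (\<lambda>s. a (q + s *\<^sub>R v)) = f (q + t *\<^sub>R v) - f q" if "t \<ge> 0" for q t
    using fundamental_theorem_of_calculus[OF that, of "\<lambda>s. f (q + s *\<^sub>R v)" "\<lambda>s. a (q + s *\<^sub>R v)"]
      smooth_has_vector_derivative_line[OF f] by (auto simp: a_def integral_unique)
  have int: "integral {0..t} (\<lambda>s. c (p + s *\<^sub>R v)) = b (p + t *\<^sub>R v) - b p" if "t \<ge> 0" for t
  proof -
    have "((\<lambda>u. integral (cbox 0 t) (\<lambda>s. a ((p + u *\<^sub>R w) + s *\<^sub>R v))) has_vector_derivative
         integral (cbox 0 t) (\<lambda>s. c ((p + 0 *\<^sub>R w) + s *\<^sub>R v))) (at 0 within UNIV)"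
    proof (rule leibniz_rule_vector_derivative)
      fix u s :: real
      show "((\<lambda>u. a ((p + u *\<^sub>R w) + s *\<^sub>R v)) has_vector_derivative c ((p + u *\<^sub>R w) + s *\<^sub>R v)) (at u within UNIV)"
        using smooth_has_vector_derivative_line[OF sm(1), of "p + s *\<^sub>R v" w u]
        by (simp add: c_def algebra_simps)
    next
      fix u :: real
      show "(\<lambda>s. a ((p + u *\<^sub>R w) + s *\<^sub>R v)) integrable_on cbox 0 t"
        by (intro integrable_continuous continuous_on_compose2[OF smooth_continuous_on[OF sm(1), of UNIV]]
          continuous_intros) auto
    next
      show "continuous_on (UNIV \<times> cbox 0 t) (\<lambda>(u, s). c ((p + u *\<^sub>R w) + s *\<^sub>R v))"
        unfolding split_beta
        by (intro continuous_on_compose2[OF smooth_continuous_on[OF sm(3), of UNIV]]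
          continuous_intros) auto
    qed auto
    then have "((\<lambda>u. f ((p + u *\<^sub>R w) + t *\<^sub>R v) - f (p + u *\<^sub>R w)) has_vector_derivative
         integral {0..t} (\<lambda>s. c (p + s *\<^sub>R v))) (at 0)"
      by (simp add: ftc[OF that])
    moreover have "((\<lambda>u. f ((p + u *\<^sub>R w) + t *\<^sub>R v) - f (p + u *\<^sub>R w)) has_vector_derivative
        b (p + t *\<^sub>R v) - b p) (at 0)"
      using has_vector_derivative_diff[OF smooth_has_vector_derivative_line[OF f, of "p + t *\<^sub>R v" w 0]
          smooth_has_vector_derivative_line[OF f, of p w 0]]
      by (simp add: b_def algebra_simps)
    ultimately show ?thesis
      by (rule vector_derivative_unique_at)
  qed
  \<comment> \<open>\<open>ftc\<close> and \<open>int\<close> are stated for t >= 0, hence the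
    one-sided derivative at 0 within \<open>{0..1}\<close>. It still determines its value
    uniquely.\<close>
  have "((\<lambda>t. integral {0..t} (\<lambda>s. c (p + s *\<^sub>R v))) has_vector_derivative c (p + 0 *\<^sub>R v)) (at 0 within {0..1})"
    by (intro integral_has_vector_derivative continuous_on_compose2[OF smooth_continuous_on[OF sm(3), of UNIV]]
          continuous_intros) auto
  then have "((\<lambda>t. integral {0..t} (\<lambda>s. c (p + s *\<^sub>R v))) has_vector_derivative c p) (at 0 within {0..1})"
    by simp
  then have "((\<lambda>t. b (p + t *\<^sub>R v) - b p) has_vector_derivative c p) (at 0 within {0..1})"
    by (rule has_vector_derivative_transform[rotated 2]) (auto simp: int)
  moreover have "((\<lambda>t. b (p + t *\<^sub>R v) - b p) has_vector_derivative frechet_derivative b (at (p + 0 *\<^sub>R v)) v) (at 0 within {0..1})"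
    using smooth_has_vector_derivative_line[OF sm(2), of p v 0 "{0..1}"]
    by (subst has_vector_derivative_diff_const)
  ultimately show ?thesis
    using vector_derivative_unique_within_closed_interval[of 0 1 0] 
    by (auto simp: a_def b_def c_def)
qed

section \<open>Closed and exact 1-forms\<close>

text \<open>The Poincare lemma, by radial integration from the origin: the potential is f(x) =
  integral over t in [0,1] of c(tx)(x), differentiated under the integral sign.\<close>

lemma closed_imp_exact:
  fixes c :: form1
  assumes sm: "\<And>v. smooth (\<lambda>p. c p v)"
    and lin: "\<And>p. linear (c p)"
    and closed: "\<And>p v w. d1 c p v w = 0"
  obtains f where "smooth f" "d0 f = c"
proof -
  define D where "D p v w = frechet_derivative (\<lambda>q. c q w) (at p) v" for p v w
  have sym: "D p v w = D p w v" for p v w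
    using closed[of p v w] by (simp add: d1_def D_def)
  have linD: "linear (\<lambda>v. D p v w)" for p w
    unfolding D_def using smooth_differentiable[OF sm]
    by (metis (no_types) linear_frechet_derivative)
  have linD': "linear (D p v)" for p v
    using linD[of p v] by (simp add: sym[of p _ v])
  \<comment> \<open>Smoothness of \<open>c\<close> and \<open>D\<close> is known for fixed tangent
    vectors. Expanding in the basis covers the terms whose vector argument x varies together with
    the base point.\<close>
  have expand: "L x = (\<Sum>i\<in>Basis. (x \<bullet> i) * L i)" if "linear L" for L :: "real^4 \<Rightarrow> real" and x
    using Linear_Algebra.linear_componentwise[OF that, of x 1] by (simp add: mult.commute)
  have smD: "smooth (\<lambda>p. D p v w)" for v w
    unfolding D_def by (intro smooth_intros sm)
  \<comment> \<open>\<open>G x t\<close> is the derivative of c(tx)(x) with respect to x. It is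
    packed as a bounded linear map because \<open>leibniz_rule\<close> requires continuity of the
    derivative in that space.\<close>
  define G where "G x t = Blinfun (\<lambda>v. t * D (t *\<^sub>R x) v x + c (t *\<^sub>R x) v)" for x :: "real^4" and t :: real
  have G: "blinfun_apply (G x t) = (\<lambda>v. t * D (t *\<^sub>R x) v x + c (t *\<^sub>R x) v)" for x t
    unfolding G_def
  proof (rule bounded_linear_Blinfun_apply, subst linear_conv_bounded_linear[symmetric])
    show "linear (\<lambda>v. t * D (t *\<^sub>R x) v x + c (t *\<^sub>R x) v)"
      using linD[of "t *\<^sub>R x" x] lin[of "t *\<^sub>R x"] by (auto simp: linear_iff algebra_simps)
  qed
  have contG: "continuous_on (UNIV \<times> cbox 0 1) (\<lambda>(x, t). G x t)"
  proof (rule continuous_on_blinfun_componentwise)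
    fix v :: "real^4"
    have "continuous_on (UNIV \<times> cbox 0 1)
      (\<lambda>z. snd z * (\<Sum>i\<in>Basis. (fst z \<bullet> i) * D (snd z *\<^sub>R fst z) v i) + c (snd z *\<^sub>R fst z) v)"
      by (intro continuous_intros
          continuous_on_compose2[OF smooth_continuous_on[OF smD, of UNIV]]
          continuous_on_compose2[OF smooth_continuous_on[OF sm, of UNIV]]) auto
    then show "continuous_on (UNIV \<times> cbox 0 1) (\<lambda>z. (case z of (x, t) \<Rightarrow> G x t) v)"
      by (simp add: split_beta G expand[OF linD', symmetric])
  qed
  define f where "f x = integral (cbox 0 1) (\<lambda>t. c (t *\<^sub>R x) x)" for x
  have "(f has_derivative blinfun_apply (integral (cbox 0 1) (G x))) (at x within UNIV)" for x
    unfolding f_def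
  proof (rule leibniz_rule)
    fix x :: "real^4" and t :: real
    have "((\<lambda>x. \<Sum>i\<in>Basis. (x \<bullet> i) * c (t *\<^sub>R x) i) has_derivative
       (\<lambda>v. \<Sum>i\<in>Basis. (x \<bullet> i) * D (t *\<^sub>R x) (t *\<^sub>R v) i + (v \<bullet> i) * c (t *\<^sub>R x) i)) (at x)"
      unfolding D_def
      by (intro has_derivative_sum has_derivative_mult has_derivative_inner_left
          has_derivative_compose[OF _ smooth_has_derivative[OF sm]]) (auto intro!: derivative_eq_intros)
    moreover have "(\<Sum>i\<in>Basis. (x \<bullet> i) * D (t *\<^sub>R x) (t *\<^sub>R v) i + (v \<bullet> i) * c (t *\<^sub>R x) i) = G x t v" for v
      unfolding sum.distrib expand[OF lin, symmetric] expand[OF linD', symmetric] G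
      by (simp add: linear_scale[OF linD])
    ultimately show "((\<lambda>x. c (t *\<^sub>R x) x) has_derivative blinfun_apply (G x t)) (at x within UNIV)"
      by (simp add: expand[OF lin, symmetric])
  next
    fix x :: "real^4"
    have "(\<lambda>t. \<Sum>i\<in>Basis. (x \<bullet> i) * c (t *\<^sub>R x) i) integrable_on cbox 0 1"
      by (intro integrable_continuous continuous_intros
          continuous_on_compose2[OF smooth_continuous_on[OF sm, of UNIV]]) auto
    then show "(\<lambda>t. c (t *\<^sub>R x) x) integrable_on cbox 0 1"
      by (simp add: expand[OF lin, symmetric])
  qed (use contG in auto)
  moreover have "blinfun_apply (integral (cbox 0 1) (G x)) = c x" for x
  proof
    fix v
    have "continuous_on (cbox 0 1) (G x)"
      using continuous_on_compose2[OF contG, of "cbox 0 1" "\<lambda>t. (x, t)"]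
      by (force intro!: continuous_intros)
    then have "blinfun_apply (integral (cbox 0 1) (G x)) v = integral (cbox 0 1) (\<lambda>t. G x t v)"
      by (intro blinfun_apply_integral integrable_continuous)
    \<comment> \<open>Closedness enters here: by \<open>sym\<close>, the term
      \<open>D (t *\<^sub>R x) v x\<close> equals \<open>D (t *\<^sub>R x) x v\<close>, and the
      integrand becomes the t-derivative of t c(tx)(v).\<close>
    also have "\<dots> = 1 * c (1 *\<^sub>R x) v - 0 * c (0 *\<^sub>R x) v"
      unfolding cbox_interval
    proof (intro integral_unique fundamental_theorem_of_calculus)
      fix t :: real
      show "((\<lambda>t. t * c (t *\<^sub>R x) v) has_vector_derivative G x t v) (at t within {0..1})"
        using has_vector_derivative_mult[OF has_vector_derivative_id
            smooth_has_vector_derivative_line[OF sm[of v], of 0 x t "{0..1}"]]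
        by (simp add: G D_def[symmetric] sym[of _ v x])
    qed simp
    finally show "blinfun_apply (integral (cbox 0 1) (G x)) v = c x v" by simp
  qed
  ultimately have f: "(f has_derivative c x) (at x)" for x by simp
  then have "smooth f"
    using sm by (subst smooth_iff) (auto simp: differentiable_def frechet_derivative_eqI[OF f])
  moreover have "d0 f = c"
    by (intro ext) (simp add: d0_def frechet_derivative_eqI[OF f])
  ultimately show thesis using that by blast
qed

section \<open>Bivectors and differential forms\<close>

lemmas h_simps = bounded_bilinear.add_left[OF bilinear_h] bounded_bilinear.add_right[OF bilinear_h]
  bounded_bilinear.scaleR_left[OF bilinear_h] bounded_bilinear.scaleR_right[OF bilinear_h]

lemma h_commute: "h x y = h y x"
  by (simp add: h_def ac_simps)

lemma sig_simps: "sig 1 = 1" "sig 2 = 1" "sig 3 = - 1" "sig 4 = - 1"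
  by (simp_all add: sig_def)

lemma sig_square: "sig i * sig i = 1"
  by (simp add: sig_def)

lemma hhat_bilinear: "bounded_bilinear hhat"
  unfolding bilinear_conv_bounded_bilinear [symmetric] bilinear_def linear_iff
  by (auto simp: hhat_def sum_4 field_simps)

lemmas hhat_simps = bounded_bilinear.add_left[OF hhat_bilinear] bounded_bilinear.add_right[OF hhat_bilinear]
  bounded_bilinear.scaleR_left[OF hhat_bilinear] bounded_bilinear.scaleR_right[OF hhat_bilinear]
  bounded_bilinear.diff_left[OF hhat_bilinear] bounded_bilinear.diff_right[OF hhat_bilinear]

lemmas bwedge_simps = bounded_bilinear.add_left[OF bilinear_bwedge] bounded_bilinear.add_right[OF bilinear_bwedge]
  bounded_bilinear.scaleR_left[OF bilinear_bwedge] bounded_bilinear.scaleR_right[OF bilinear_bwedge]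
  bounded_bilinear.minus_left[OF bilinear_bwedge] bounded_bilinear.minus_right[OF bilinear_bwedge]
  bounded_bilinear.diff_left[OF bilinear_bwedge] bounded_bilinear.diff_right[OF bilinear_bwedge]

lemmas smooth_bwedge = bounded_bilinear.smooth_prod[OF bilinear_bwedge]

lemma bwedge_self: "bwedge x x = 0"
  by (simp add: bwedge_def vec_eq_iff mult.commute)

lemma bwedge_swap: "bwedge y x = - bwedge x y"
  by (simp add: bwedge_def vec_eq_iff mult.commute)

section \<open>Leibniz rules for \<open>nabla\<close> and for the exterior derivative\<close>

lemma nabla_add:
  assumes "X differentiable (at p)" "Y differentiable (at p)"
  shows "nabla (\<lambda>q. X q + Y q) p v = nabla X p v + nabla Y p v"
  using frechet_derivative_eqI[OF has_derivative_add[OF assms[unfolded frechet_derivative_works]]]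
  by (simp add: nabla_def)

lemma nabla_const_scaleR:
  assumes "X differentiable (at p)"
  shows "nabla (\<lambda>q. c *\<^sub>R X q) p v = c *\<^sub>R nabla X p v"
  using frechet_derivative_eqI[OF has_derivative_scaleR_right[OF assms[unfolded frechet_derivative_works]]]
  by (simp add: nabla_def)

lemma nabla_scaleR:
  assumes "f differentiable (at p)" "X differentiable (at p)"
  shows "nabla (\<lambda>q. f q *\<^sub>R X q) p v = d0 f p v *\<^sub>R X p + f p *\<^sub>R nabla X p v"
proof -
  have "((\<lambda>q. f q *\<^sub>R X q) has_derivative
      (\<lambda>v. f p *\<^sub>R frechet_derivative X (at p) v + frechet_derivative f (at p) v *\<^sub>R X p)) (at p)"
    using assms unfolding frechet_derivative_works by (rule has_derivative_scaleR)
  from frechet_derivative_eqI[OF this] show ?thesis by (simp add: nabla_def d0_def)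
qed

lemma d1_add:
  assumes "\<And>v. smooth (\<lambda>p. a p v)" "\<And>v. smooth (\<lambda>p. b p v)"
  shows "d1 (\<lambda>p v. a p v + b p v) p v w = d1 a p v w + d1 b p v w"
  using assms by (simp add: d1_def nabla_add[unfolded nabla_def] smooth_differentiable)

lemma d1_mult:
  assumes "smooth f" "\<And>v. smooth (\<lambda>p. a p v)"
  shows "d1 (\<lambda>p v. f p * a p v) p v w = fwedge (d0 f) a p v w + f p * d1 a p v w"
proof -
  have "frechet_derivative (\<lambda>q. f q * a q w) (at p) v
      = d0 f p v * a p w + f p * frechet_derivative (\<lambda>q. a q w) (at p) v" for v w
    using nabla_scaleR[of f p "\<lambda>q. a q w" v] assms
    by (simp add: nabla_def smooth_differentiable)
  then show ?thesis by (simp add: d1_def fwedge_def algebra_simps)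
qed

lemma d1_const_mult:
  assumes "\<And>v. smooth (\<lambda>p. a p v)"
  shows "d1 (\<lambda>p v. c * a p v) p v w = c * d1 a p v w"
  using d1_mult[OF smooth_const[of c] assms] by (simp add: fwedge_def d0_def)

text \<open>A vector space is not the union of two proper subspaces, here the kernels of b - a and b
  + a: if v lies outside the first and w outside the second, then v + w lies in neither.\<close>

lemma linear_forms_square_eq:
  fixes a b :: "'a::real_vector \<Rightarrow> real"
  assumes "linear a" "linear b" and sq: "\<And>v. (a v)\<^sup>2 = (b v)\<^sup>2"
  shows "(\<forall>v. b v = a v) \<or> (\<forall>v. b v = - a v)"
proof (rule ccontr)
  assume "\<not> ?thesis"
  then obtain v w where "b v \<noteq> a v" "b w \<noteq> - a w" by blast
  moreover have "b v = - a v" "b w = a w"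
    using sq[of v] sq[of w] calculation by (auto simp: power2_eq_iff)
  moreover have "a (v + w) = a v + a w" "b (v + w) = b v + b w"
    using assms(1,2) by (simp_all add: linear_add)
  ultimately show False
    using sq[of "v + w"] by (auto simp: power2_eq_iff)
qed

text \<open>The sets where b = a and where b = -a are closed, cover the space, and are disjoint
  because no \<open>a p\<close> vanishes identically. Connectedness leaves only one of them.\<close>

lemma constant_sign:
  fixes a b :: "'b::topological_space \<Rightarrow> 'c \<Rightarrow> real"
  assumes "connected (UNIV :: 'b set)"
    and "\<And>v. continuous_on UNIV (\<lambda>p. a p v)" "\<And>v. continuous_on UNIV (\<lambda>p. b p v)"
    and cov: "\<And>p. (\<forall>v. b p v = a p v) \<or> (\<forall>v. b p v = - a p v)"
    and nz: "\<And>p. \<exists>v. a p v \<noteq> 0"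
  obtains \<mu> :: real where "\<mu> \<in> {1, - 1}" "\<And>p v. b p v = \<mu> * a p v"
proof -
  define A where "A s = {p. \<forall>v. b p v = s * a p v}" for s
  have "closed (A s)" for s
    unfolding A_def using assms(2,3)
    by (intro closed_Collect_all closed_Collect_eq continuous_intros)
  moreover have "UNIV \<subseteq> A 1 \<union> A (- 1)" using cov by (auto simp: A_def)
  moreover have "A 1 \<inter> A (- 1) \<inter> UNIV = {}"
  proof -
    have False if "p \<in> A 1" "p \<in> A (- 1)" for p
      using nz[of p] that by (auto simp: A_def)
    then show ?thesis by blast
  qed
  ultimately have "A 1 \<inter> UNIV = {} \<or> A (- 1) \<inter> UNIV = {}"
    using assms(1) unfolding connected_closed by blast
  then have "A 1 = UNIV \<or> A (- 1) = UNIV"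
    using \<open>UNIV \<subseteq> A 1 \<union> A (- 1)\<close> by auto
  then show thesis
  proof
    assume "A 1 = UNIV" then show thesis using that[of 1] by (auto simp: A_def)
  next
    assume "A (- 1) = UNIV" then show thesis using that[of "- 1"] by (auto simp: A_def)
  qed
qed

section \<open>Hyperbolic functions and 4 x 4 determinants, in preparation for the boost\<close>

lemma smooth_cosh: "smooth f \<Longrightarrow> smooth (\<lambda>p. cosh (f p :: real))"
  and smooth_sinh: "smooth f \<Longrightarrow> smooth (\<lambda>p. sinh (f p :: real))"
  unfolding cosh_def sinh_def by (intro smooth_intros; assumption)+

lemma cosh_cosh: "cosh x * cosh x = 1 + sinh x * sinh (x::real)"
  using cosh_square_eq[of x] by (simp add: power2_eq_square)

text \<open>The full Leibniz expansion turns the comparison of the orientations of two frames into a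
  polynomial identity.\<close>

lemma det_4:
  "det (A :: 'a::comm_ring_1 ^ 4 ^ 4) =
    A$1$1 * A$2$2 * A$3$3 * A$4$4 + A$1$1 * A$2$3 * A$3$4 * A$4$2 + A$1$1 * A$2$4 * A$3$2 * A$4$3
  - A$1$1 * A$2$2 * A$3$4 * A$4$3 - A$1$1 * A$2$3 * A$3$2 * A$4$4 - A$1$1 * A$2$4 * A$3$3 * A$4$2
  - A$1$2 * A$2$1 * A$3$3 * A$4$4 - A$1$2 * A$2$3 * A$3$4 * A$4$1 - A$1$2 * A$2$4 * A$3$1 * A$4$3
  + A$1$2 * A$2$1 * A$3$4 * A$4$3 + A$1$2 * A$2$3 * A$3$1 * A$4$4 + A$1$2 * A$2$4 * A$3$3 * A$4$1
  + A$1$3 * A$2$1 * A$3$2 * A$4$4 + A$1$3 * A$2$2 * A$3$4 * A$4$1 + A$1$3 * A$2$4 * A$3$1 * A$4$2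
  - A$1$3 * A$2$1 * A$3$4 * A$4$2 - A$1$3 * A$2$2 * A$3$1 * A$4$4 - A$1$3 * A$2$4 * A$3$2 * A$4$1
  - A$1$4 * A$2$1 * A$3$2 * A$4$3 - A$1$4 * A$2$2 * A$3$3 * A$4$1 - A$1$4 * A$2$3 * A$3$1 * A$4$2
  + A$1$4 * A$2$1 * A$3$3 * A$4$2 + A$1$4 * A$2$2 * A$3$1 * A$4$3 + A$1$4 * A$2$3 * A$3$2 * A$4$1"
proof -
  have f1234: "finite {2::4, 3, 4}" "1 \<notin> {2::4, 3, 4}"
    and f234: "finite {3::4, 4}" "2 \<notin> {3::4, 4}"
    and f34: "finite {4::4}" "3 \<notin> {4::4}"
    by auto
  show ?thesis
    unfolding det_def UNIV_4 sum_over_permutations_insert[OF f1234] sum_over_permutations_insert[OF f234]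
      sum_over_permutations_insert[OF f34] permutes_sing
    by (simp add: sign_swap_id permutation_swap_id permutation_compose sign_compose sign_id transpose_def algebra_simps)
qed

section \<open>Moving frames\<close>

locale moving_frame =
  fixes e :: frame and \<omega> :: "4 \<Rightarrow> 4 \<Rightarrow> form1"
  assumes frame: "oriented_frame_field e" and connection: "connection_form e \<omega>"
begin

lemma smooth_e: "smooth (e i)"
  using frame by (simp add: oriented_frame_field_def)

lemma h_e: "h (e i p) (e j p) = (if i = j then sig i else 0)"
  using frame by (simp add: oriented_frame_field_def)

lemma nabla_e: "nabla (e j) p v = (\<Sum>i\<in>UNIV. \<omega> i j p v *\<^sub>R e i p)"
  using connection by (simp add: connection_form_def)

lemma h_nabla_e: "h (nabla (e j) p v) (e i p) = sig i * \<omega> i j p v"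
  using exhaust_4[of i] by (auto simp: nabla_e sum_4 h_simps h_e)

text \<open>Recovers the connection form from the frame. Smoothness and linearity of its entries are
  derived from this formula.\<close>

lemma omega_eq: "\<omega> i j p v = sig i * h (nabla (e j) p v) (e i p)"
  by (simp add: h_nabla_e sig_square mult.assoc[symmetric])

lemma smooth_nabla_e: "smooth (\<lambda>p. nabla (e j) p v)"
  unfolding nabla_def by (intro smooth_intros smooth_e)

lemma smooth_omega: "smooth (\<lambda>p. \<omega> i j p v)"
  unfolding omega_eq by (intro smooth_intros smooth_e smooth_nabla_e)

lemma linear_omega: "linear (\<omega> i j p)"
  using linear_frechet_derivative[OF smooth_differentiable[OF smooth_e[of j]], of p]
  by (auto simp: linear_iff omega_eq[abs_def] nabla_def h_simps algebra_simps)

text \<open>Metric compatibility applied to the constant functions h(e_i, e_j): with its upper index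
  lowered, the connection form is skew.\<close>

lemma omega_skew: "sig i * \<omega> i j p v = - (sig j * \<omega> j i p v)"
proof -
  have "0 = frechet_derivative (\<lambda>q. h (e i q) (e j q)) (at p) v"
    by (simp add: h_e)
  also have "\<dots> = h (nabla (e i) p v) (e j p) + h (e i p) (nabla (e j) p v)"
    by (intro nabla_metric smooth_differentiable smooth_e)
  finally show ?thesis
    by (simp add: h_commute[of "e i p"] h_nabla_e)
qed

text \<open>Reduces the sixteen entries to the six below the diagonal. Within the space-like or the
  time-like block the entries are skew; between the blocks the signature makes them
  symmetric.\<close>

lemma omega_simps:
  "\<omega> 1 1 p v = 0" "\<omega> 2 2 p v = 0" "\<omega> 3 3 p v = 0" "\<omega> 4 4 p v = 0"
  "\<omega> 1 2 p v = - \<omega> 2 1 p v" "\<omega> 1 3 p v = \<omega> 3 1 p v" "\<omega> 1 4 p v = \<omega> 4 1 p v"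
  "\<omega> 2 3 p v = \<omega> 3 2 p v" "\<omega> 2 4 p v = \<omega> 4 2 p v" "\<omega> 3 4 p v = - \<omega> 4 3 p v"
  using omega_skew[of 1 1 p v] omega_skew[of 2 2 p v] omega_skew[of 3 3 p v] omega_skew[of 4 4 p v]
    omega_skew[of 1 2 p v] omega_skew[of 1 3 p v] omega_skew[of 1 4 p v]
    omega_skew[of 2 3 p v] omega_skew[of 2 4 p v] omega_skew[of 3 4 p v]
  unfolding sig_simps by linarith+

text \<open>Cartan's second structure equation with zero curvature. Differentiating
  \<open>omega_eq\<close> gives a second derivative of e_j, which is symmetric in v and w and so
  cancels in \<open>d1\<close>, and a product of first derivatives, which yields the wedge
  products.\<close>

lemma structure_equation: "d1 (\<omega> i j) p v w = - (\<Sum>k\<in>UNIV. fwedge (\<omega> i k) (\<omega> k j) p v w)"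
proof -
  define N where "N w = (\<lambda>q. nabla (e j) q w)" for w
  have D: "frechet_derivative (\<lambda>q. \<omega> i j q w) (at p) v
      = sig i * (h (nabla (N w) p v) (e i p) + h (N w p) (nabla (e i) p v))" for v w
  proof -
    have "frechet_derivative (\<lambda>q. \<omega> i j q w) (at p) v
        = nabla (\<lambda>q. sig i *\<^sub>R h (N w q) (e i q)) p v"
      by (simp add: omega_eq N_def nabla_def)
    also have "\<dots> = sig i *\<^sub>R nabla (\<lambda>q. h (N w q) (e i q)) p v"
      unfolding N_def
      by (intro nabla_const_scaleR smooth_differentiable smooth_intros smooth_nabla_e smooth_e)
    also have "nabla (\<lambda>q. h (N w q) (e i q)) p v
        = h (nabla (N w) p v) (e i p) + h (N w p) (nabla (e i) p v)"
      unfolding N_def nabla_def[of "\<lambda>q. h (nabla (e j) q w) (e i q)"]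
      by (intro nabla_metric smooth_differentiable smooth_nabla_e smooth_e)
    finally show ?thesis by simp
  qed
  have flat: "nabla (N w) p v = nabla (N v) p w"
    unfolding N_def nabla_def by (rule frechet_derivative_commute[OF smooth_e])
  have hh: "h (N w p) (nabla (e i) p v) = (\<Sum>k\<in>UNIV. \<omega> k j p w * (sig k * \<omega> k i p v))" for v w
    by (simp add: N_def nabla_e sum_4 h_simps h_e algebra_simps)
  \<comment> \<open>\<open>omega_skew\<close> exchanges the indices of \<open>\<omega> k i\<close>,
    which produces the minus sign; the leftover factor \<open>sig i * sig i\<close> is 1.\<close>
  have "sig i * h (N w p) (nabla (e i) p v) = - (\<Sum>k\<in>UNIV. \<omega> i k p v * \<omega> k j p w)" for v w
  proof -
    have "sig i * h (N w p) (nabla (e i) p v)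
        = (\<Sum>k\<in>UNIV. sig i * (\<omega> k j p w * - (sig i * \<omega> i k p v)))"
      unfolding hh sum_distrib_left by (simp only: omega_skew[of _ i])
    also have "\<dots> = (\<Sum>k\<in>UNIV. - ((sig i * sig i) * (\<omega> i k p v * \<omega> k j p w)))"
      by (intro sum.cong) (simp_all only: ac_simps mult_minus_right)
    finally show ?thesis by (simp add: sig_square sum_negf)
  qed
  then show ?thesis
    by (simp add: d1_def D flat distrib_left fwedge_def sum_subtractf)
qed

text \<open>\<open>Omega1\<close>, \<open>Omega2\<close> and \<open>Omega3\<close> all have this
  shape, so one product rule serves the three.\<close>

lemma nabla_bwedge_pair:
  "nabla (\<lambda>q. c *\<^sub>R (bwedge (e i q) (e j q) + s *\<^sub>R bwedge (e k q) (e l q))) p v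
    = c *\<^sub>R (bwedge (nabla (e i) p v) (e j p) + bwedge (e i p) (nabla (e j) p v)
      + s *\<^sub>R (bwedge (nabla (e k) p v) (e l p) + bwedge (e k p) (nabla (e l) p v)))"
proof -
  have D: "(\<lambda>q. bwedge (e i q) (e j q)) differentiable (at p)"
    "(\<lambda>q. s *\<^sub>R bwedge (e i q) (e j q)) differentiable (at p)" for i j
    by (intro smooth_differentiable smooth_intros smooth_bwedge smooth_e)+
  have N: "nabla (\<lambda>q. bwedge (e i q) (e j q)) p v
      = bwedge (nabla (e i) p v) (e j p) + bwedge (e i p) (nabla (e j) p v)" for i j
    by (intro nabla_bwedge smooth_differentiable smooth_e)
  have "nabla (\<lambda>q. c *\<^sub>R (bwedge (e i q) (e j q) + s *\<^sub>R bwedge (e k q) (e l q))) p v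
      = c *\<^sub>R nabla (\<lambda>q. bwedge (e i q) (e j q) + s *\<^sub>R bwedge (e k q) (e l q)) p v"
    by (intro nabla_const_scaleR differentiable_add D)
  also have "nabla (\<lambda>q. bwedge (e i q) (e j q) + s *\<^sub>R bwedge (e k q) (e l q)) p v
      = nabla (\<lambda>q. bwedge (e i q) (e j q)) p v + s *\<^sub>R nabla (\<lambda>q. bwedge (e k q) (e l q)) p v"
    by (simp add: nabla_add[OF D] nabla_const_scaleR[OF D(1)])
  finally show ?thesis unfolding N .
qed

lemma bwedge_e_swap:
  "bwedge (e 2 p) (e 1 p) = - bwedge (e 1 p) (e 2 p)"
  "bwedge (e 3 p) (e 1 p) = - bwedge (e 1 p) (e 3 p)"
  "bwedge (e 4 p) (e 1 p) = - bwedge (e 1 p) (e 4 p)"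
  "bwedge (e 3 p) (e 2 p) = - bwedge (e 2 p) (e 3 p)"
  "bwedge (e 4 p) (e 2 p) = - bwedge (e 2 p) (e 4 p)"
  "bwedge (e 4 p) (e 3 p) = - bwedge (e 3 p) (e 4 p)"
  by (rule bwedge_swap)+

lemma smooth_Omega: "smooth (Omega1 s e)" "smooth (Omega3 s e)"
  unfolding Omega1_def[abs_def] Omega3_def[abs_def]
  by (intro smooth_intros smooth_bwedge smooth_e)+

section \<open>The parallel rank-3 bundle spanned by \<open>Omega1 (- \<epsilon>)\<close>,
  \<open>Omega2 \<epsilon>\<close> and \<open>Omega3 \<epsilon>\<close>\<close>

context
  fixes \<epsilon> :: real
  assumes eps: "\<epsilon> \<in> {1, - 1}"
begin

text \<open>For either sign the components in the opposite rank-3 bundle cancel, here and in the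
  next two lemmas, so that only the forms a, b, c survive out of the six connection forms.\<close>

lemma nabla_Omega1:
  "nabla (Omega1 (- \<epsilon>) e) p v = (\<omega> 3 2 p v + \<epsilon> * \<omega> 4 1 p v) *\<^sub>R Omega2 \<epsilon> e p
    + (\<omega> 4 2 p v - \<epsilon> * \<omega> 3 1 p v) *\<^sub>R Omega3 \<epsilon> e p"
  using eps unfolding Omega1_def[abs_def] Omega2_def[abs_def] Omega3_def[abs_def] nabla_bwedge_pair
    nabla_e sum_4 omega_simps
  by (auto simp: bwedge_simps bwedge_self bwedge_e_swap algebra_simps)

lemma nabla_Omega2:
  "nabla (Omega2 \<epsilon> e) p v = (\<omega> 3 2 p v + \<epsilon> * \<omega> 4 1 p v) *\<^sub>R Omega1 (- \<epsilon>) e p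
    + (\<omega> 4 3 p v + \<epsilon> * \<omega> 2 1 p v) *\<^sub>R Omega3 \<epsilon> e p"
  using eps unfolding Omega1_def[abs_def] Omega2_def[abs_def] Omega3_def[abs_def] nabla_bwedge_pair
    nabla_e sum_4 omega_simps
  by (auto simp: bwedge_simps bwedge_self bwedge_e_swap algebra_simps)

lemma nabla_Omega3:
  "nabla (Omega3 \<epsilon> e) p v = (\<omega> 4 2 p v - \<epsilon> * \<omega> 3 1 p v) *\<^sub>R Omega1 (- \<epsilon>) e p
    - (\<omega> 4 3 p v + \<epsilon> * \<omega> 2 1 p v) *\<^sub>R Omega2 \<epsilon> e p"
  using eps unfolding Omega1_def[abs_def] Omega2_def[abs_def] Omega3_def[abs_def] nabla_bwedge_pair
    nabla_e sum_4 omega_simps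
  by (auto simp: bwedge_simps bwedge_self bwedge_e_swap algebra_simps)

lemma hhat_Omega:
  "hhat (Omega1 (- \<epsilon>) e p) (Omega1 (- \<epsilon>) e p) = 1"
  "hhat (Omega1 (- \<epsilon>) e p) (Omega3 \<epsilon> e p) = 0"
  "hhat (Omega3 \<epsilon> e p) (Omega1 (- \<epsilon>) e p) = 0"
  "hhat (Omega3 \<epsilon> e p) (Omega3 \<epsilon> e p) = - 1"
  using eps by (auto simp: Omega1_def Omega3_def hhat_simps hhat_bwedge h_e sig_simps real_div_sqrt)

lemma light_like_Omega0:
  assumes "\<mu> \<in> {1, - 1}"
  shows "light_like (Omega0 \<epsilon> \<mu> e p)"
proof -
  \<comment> \<open>Pairing with the space-like \<open>Omega1 (- \<epsilon>)\<close> shows that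
    \<open>Omega0\<close> is nonzero, which its own vanishing length cannot show.\<close>
  have "hhat (Omega0 \<epsilon> \<mu> e p) (Omega1 (- \<epsilon>) e p) = 1"
    by (simp add: Omega0_def hhat_simps hhat_Omega)
  then have "Omega0 \<epsilon> \<mu> e p \<noteq> 0"
    using bounded_bilinear.zero_left[OF hhat_bilinear] by fastforce
  moreover have "hhat (Omega0 \<epsilon> \<mu> e p) (Omega0 \<epsilon> \<mu> e p) = 0"
    using assms by (auto simp: Omega0_def hhat_simps hhat_Omega)
  ultimately show ?thesis by (simp add: light_like_def)
qed

text \<open>Multiplied by suitable signs, the formulas of (b) for \<open>\<omega> 4 1\<close> and
  \<open>\<omega> 4 3\<close> say that a = alpha and b = mu alpha.\<close>

lemma nabla_Omega2_eq_alpha: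
  assumes "condition_b \<epsilon> \<omega> f g \<mu>"
  shows "nabla (Omega2 \<epsilon> e) p v = alpha \<mu> f g p v *\<^sub>R Omega0 \<epsilon> \<mu> e p"
proof -
  have "\<omega> 3 2 p v + \<epsilon> * \<omega> 4 1 p v = alpha \<mu> f g p v"
    "\<omega> 4 3 p v + \<epsilon> * \<omega> 2 1 p v = \<mu> * alpha \<mu> f g p v"
    using assms eps by (auto simp: condition_b_def alpha_def)
  then show ?thesis
    by (simp add: nabla_Omega2 Omega0_def algebra_simps)
qed

lemma condition_b_imp_fully_light_like:
  assumes "condition_b \<epsilon> \<omega> f g \<mu>"
  shows "fully_light_like (Omega2 \<epsilon> e)"
proof -
  have \<mu>: "\<mu> \<in> {1, - 1}" and g: "\<exists>v. d0 g p v \<noteq> 0" for p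
    using assms by (auto simp: condition_b_def)
  have "light_like (c *\<^sub>R Omega0 \<epsilon> \<mu> e p) \<or> c *\<^sub>R Omega0 \<epsilon> \<mu> e p = 0" for c p
    using light_like_Omega0[OF \<mu>, of p] by (auto simp: light_like_def hhat_simps)
  moreover have "\<exists>v. alpha \<mu> f g p v *\<^sub>R Omega0 \<epsilon> \<mu> e p \<noteq> 0" for p
    using light_like_Omega0[OF \<mu>, of p] g[of p] by (auto simp: light_like_def alpha_def)
  ultimately show ?thesis
    by (simp add: fully_light_like_def nabla_Omega2_eq_alpha[OF assms])
qed

text \<open>The \<open>Omega2\<close> component is a - mu b, which vanishes since b = mu a and mu
  squares to 1. The rest is -c times \<open>Omega3\<close> + mu \<open>Omega1\<close>, that is -mu c
  times \<open>Omega0\<close>, with c = df.\<close>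

lemma nabla_Omega0:
  assumes "condition_b \<epsilon> \<omega> f g \<mu>"
  shows "nabla (Omega0 \<epsilon> \<mu> e) p v = - (\<mu> * d0 f p v) *\<^sub>R Omega0 \<epsilon> \<mu> e p"
proof -
  have eqs: "\<omega> 3 2 p v + \<epsilon> * \<omega> 4 1 p v = alpha \<mu> f g p v"
    "\<omega> 4 3 p v + \<epsilon> * \<omega> 2 1 p v = \<mu> * alpha \<mu> f g p v"
    "\<omega> 4 2 p v - \<epsilon> * \<omega> 3 1 p v = - d0 f p v"
    and \<mu>: "\<mu> \<in> {1, - 1}"
    using assms eps by (auto simp: condition_b_def alpha_def)
  have split: "nabla (Omega0 \<epsilon> \<mu> e) p v = nabla (Omega1 (- \<epsilon>) e) p v + \<mu> *\<^sub>R nabla (Omega3 \<epsilon> e) p v"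
    unfolding Omega0_def[abs_def]
    by (subst nabla_add nabla_const_scaleR, (intro smooth_differentiable smooth_intros smooth_Omega)+)+ simp
  show ?thesis
    unfolding split nabla_Omega1 nabla_Omega3 eqs Omega0_def[of \<epsilon> \<mu> e p]
    using \<mu> by (elim insertE emptyE) (simp_all add: algebra_simps)
qed

text \<open>The formulas for the exterior derivatives in (b) are \<open>structure_equation\<close>
  for \<open>\<omega> 2 1\<close>, \<open>\<omega> 3 1\<close>, \<open>\<omega> 3 2\<close>, once
  \<open>\<omega> 4 1\<close>, \<open>\<omega> 4 2\<close>, \<open>\<omega> 4 3\<close> have been
  eliminated through a, b, c.\<close>

lemma condition_bI:
  assumes "smooth f" "smooth g" and g: "\<And>p. \<exists>v. d0 g p v \<noteq> 0" and \<mu>: "\<mu> \<in> {1, - 1}"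
    and a: "\<And>p v. \<omega> 3 2 p v + \<epsilon> * \<omega> 4 1 p v = exp (\<mu> * f p) * d0 g p v"
    and b: "\<And>p v. \<omega> 4 3 p v + \<epsilon> * \<omega> 2 1 p v = \<mu> * (exp (\<mu> * f p) * d0 g p v)"
    and c: "\<And>p v. \<epsilon> * \<omega> 3 1 p v - \<omega> 4 2 p v = d0 f p v"
  shows "condition_b \<epsilon> \<omega> f g \<mu>"
proof -
  have \<omega>: "\<omega> 4 1 p v = \<epsilon> * exp (\<mu> * f p) * d0 g p v - \<epsilon> * \<omega> 3 2 p v"
    "\<omega> 4 2 p v = \<epsilon> * \<omega> 3 1 p v - d0 f p v"
    "\<omega> 4 3 p v = \<mu> * exp (\<mu> * f p) * d0 g p v - \<epsilon> * \<omega> 2 1 p v" for p v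
    using eps a[of p v] b[of p v] c[of p v] by auto
  show ?thesis
    unfolding condition_b_def
    using assms(1-4) eps
    by (auto simp: structure_equation sum_4 fwedge_def omega_simps \<omega> algebra_simps)
qed

lemma fully_light_like_imp_condition_b:
  assumes "fully_light_like (Omega2 \<epsilon> e)"
  shows "\<exists>f g \<mu>. condition_b \<epsilon> \<omega> f g \<mu>"
proof -
  define a where "a p v = \<omega> 3 2 p v + \<epsilon> * \<omega> 4 1 p v" for p v
  define b where "b p v = \<omega> 4 3 p v + \<epsilon> * \<omega> 2 1 p v" for p v
  define c where "c p v = \<epsilon> * \<omega> 3 1 p v + (- 1) * \<omega> 4 2 p v" for p v
  have smooth: "smooth (\<lambda>p. a p v)" "smooth (\<lambda>p. b p v)" "smooth (\<lambda>p. c p v)" for v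
    unfolding a_def b_def c_def by (intro smooth_intros smooth_omega)+
  have linear: "linear (a p)" "linear (b p)" "linear (c p)" for p
    unfolding a_def[abs_def] b_def[abs_def] c_def[abs_def]
    using linear_omega[of _ _ p] by (auto simp: linear_iff algebra_simps)
  have nabla: "nabla (Omega2 \<epsilon> e) p v = a p v *\<^sub>R Omega1 (- \<epsilon>) e p + b p v *\<^sub>R Omega3 \<epsilon> e p" for p v
    by (simp add: nabla_Omega2 a_def b_def)
  have "hhat (nabla (Omega2 \<epsilon> e) p v) (nabla (Omega2 \<epsilon> e) p v) = 0" for p v
    using assms bounded_bilinear.zero_left[OF hhat_bilinear]
    by (metis fully_light_like_def light_like_def)
  then have sq: "(a p v)\<^sup>2 = (b p v)\<^sup>2" for p v
    by (simp add: nabla hhat_simps hhat_Omega power2_eq_square)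
  \<comment> \<open>Where a(v) = 0, \<open>sq\<close> forces b(v) = 0 as well, and the whole
    derivative in direction v vanishes.\<close>
  have nz: "\<exists>v. a p v \<noteq> 0" for p
  proof -
    obtain v where "nabla (Omega2 \<epsilon> e) p v \<noteq> 0"
      using assms by (auto simp: fully_light_like_def)
    then show ?thesis using sq[of p v] by (cases "a p v = 0") (auto simp: nabla)
  qed
  obtain \<mu> where \<mu>: "\<mu> \<in> {1, - 1}" and ba: "\<And>p v. b p v = \<mu> * a p v"
    using constant_sign[of a b, OF connected_UNIV smooth_continuous_on[OF smooth(1)]
        smooth_continuous_on[OF smooth(2)] linear_forms_square_eq[OF linear(1,2) sq] nz] by blast
  have \<omega>: "\<omega> 4 1 p v = \<epsilon> * a p v - \<epsilon> * \<omega> 3 2 p v"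
    "\<omega> 4 2 p v = \<epsilon> * \<omega> 3 1 p v - c p v"
    "\<omega> 4 3 p v = \<mu> * a p v - \<epsilon> * \<omega> 2 1 p v" for p v
    using eps a_def[of p v] b_def[of p v] c_def[of p v] ba[of p v] by auto
  have "d1 c p v w = \<epsilon> * d1 (\<omega> 3 1) p v w + (- 1) * d1 (\<omega> 4 2) p v w" for p v w
    unfolding c_def[abs_def]
    by (subst d1_add d1_const_mult, (intro smooth_intros smooth_omega)+)+ simp
  \<comment> \<open>The structure equations give dc = b wedge a, and b = mu a makes this
    zero.\<close>
  then have "d1 c p v w = 0" for p v w
    using eps by (auto simp: structure_equation sum_4 fwedge_def omega_simps \<omega> algebra_simps)
  then obtain f where f: "smooth f" "d0 f = c"
    using closed_imp_exact[OF smooth(3) linear(3)] by blast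
  have "d1 a p v w = d1 (\<omega> 3 2) p v w + \<epsilon> * d1 (\<omega> 4 1) p v w" for p v w
    unfolding a_def[abs_def]
    by (subst d1_add d1_const_mult, (intro smooth_intros smooth_omega)+)+ simp
  \<comment> \<open>Here the structure equations give da = c wedge b, again with b = mu a.\<close>
  then have da: "d1 a p v w = \<mu> * fwedge c a p v w" for p v w
    using eps by (auto simp: structure_equation sum_4 fwedge_def omega_simps \<omega> algebra_simps)
  \<comment> \<open>An integrating factor for a: since d\<phi> = -mu \<phi> c, the two terms of
    d(\<phi> a) cancel by \<open>da\<close>.\<close>
  define \<phi> where "\<phi> p = exp (- \<mu> * f p)" for p
  have \<phi>: "smooth \<phi>" "d0 \<phi> p v = - \<mu> * \<phi> p * c p v" for p v
  proof -
    show "smooth \<phi>" unfolding \<phi>_def[abs_def] by (intro smooth_intros f)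
    have "(\<phi> has_derivative (\<lambda>v. - \<mu> * \<phi> p * c p v)) (at p)"
      unfolding \<phi>_def[abs_def] f(2)[symmetric] d0_def
      by (rule derivative_eq_intros smooth_has_derivative f refl)+ (simp add: algebra_simps)
    from frechet_derivative_eqI[OF this] show "d0 \<phi> p v = - \<mu> * \<phi> p * c p v"
      by (simp add: d0_def)
  qed
  have "d1 (\<lambda>p v. \<phi> p * a p v) p v w = 0" for p v w
    by (simp add: d1_mult[OF \<phi>(1) smooth(1)] da fwedge_def \<phi>(2) algebra_simps)
  moreover have "linear (\<lambda>v. \<phi> p * a p v)" for p
    using linear(1)[of p] by (auto simp: linear_iff algebra_simps)
  ultimately obtain g where g: "smooth g" "d0 g = (\<lambda>p v. \<phi> p * a p v)"
    using closed_imp_exact[of "\<lambda>p v. \<phi> p * a p v"] smooth_mult[OF \<phi>(1) smooth(1)] by blast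
  have "exp (\<mu> * f p) * d0 g p v = a p v" for p v
    by (simp add: g \<phi>_def exp_minus)
  moreover have "\<exists>v. d0 g p v \<noteq> 0" for p
    using nz[of p] by (simp add: g \<phi>_def)
  ultimately have "condition_b \<epsilon> \<omega> f g \<mu>"
    using f g(1) \<mu> ba by (intro condition_bI) (simp_all add: a_def b_def c_def)
  then show ?thesis by blast
qed

end

section \<open>Boosted frames\<close>

definition boost :: "(real^4 \<Rightarrow> real) \<Rightarrow> frame" where
  "boost f i p = (if i = 2 then cosh (f p) *\<^sub>R e 2 p + sinh (f p) *\<^sub>R e 4 p
    else if i = 4 then sinh (f p) *\<^sub>R e 2 p + cosh (f p) *\<^sub>R e 4 p else e i p)"

lemma boost_simps:
  "boost f 1 p = e 1 p"
  "boost f 2 p = cosh (f p) *\<^sub>R e 2 p + sinh (f p) *\<^sub>R e 4 p"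
  "boost f 3 p = e 3 p"
  "boost f 4 p = sinh (f p) *\<^sub>R e 2 p + cosh (f p) *\<^sub>R e 4 p"
  by (simp_all add: boost_def)

lemma oriented_frame_field_boost:
  assumes "smooth f"
  shows "oriented_frame_field (boost f)"
  unfolding oriented_frame_field_def
proof (intro conjI allI)
  show "smooth (boost f i)" for i
    using exhaust_4[of i] by (auto simp: boost_def[abs_def]
        intro!: smooth_intros smooth_cosh smooth_sinh smooth_e assms)
next
  fix p
  have "\<forall>i j. h (boost f i p) (boost f j p) = (if i = j then sig i else 0)"
    unfolding forall_4 boost_simps
    by (simp add: h_simps h_e sig_simps cosh_cosh algebra_simps)
  then show "h (boost f i p) (boost f j p) = (if i = j then sig i else 0)" for i j
    by blast
next
  fix p
  \<comment> \<open>The boost acts on two columns with determinant cosh^2 - sinh^2 = 1, so the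
    orientation is kept.\<close>
  have "det (\<chi> i j. boost f j p $ i)
      = (cosh (f p) * cosh (f p) - sinh (f p) * sinh (f p)) * det (\<chi> i j. e j p $ i)"
    unfolding det_4 by (simp add: boost_simps) algebra
  then show "det (\<chi> i j. boost f j p $ i) > 0"
    using frame by (simp add: cosh_cosh oriented_frame_field_def)
qed

text \<open>e_1 and e_3 are kept, and the wedge of e_4 and e_2 is multiplied by the determinant of
  the boost, which is 1.\<close>

lemma Omega2_boost: "Omega2 \<epsilon> (boost f) = Omega2 \<epsilon> e"
proof
  fix p
  have "bwedge (boost f 4 p) (boost f 2 p)
      = (cosh (f p) * cosh (f p) - sinh (f p) * sinh (f p)) *\<^sub>R bwedge (e 4 p) (e 2 p)"
    by (simp add: boost_simps bwedge_simps bwedge_self bwedge_e_swap algebra_simps)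
  then show "Omega2 \<epsilon> (boost f) p = Omega2 \<epsilon> e p"
    by (simp add: Omega2_def boost_simps(1,3) cosh_cosh)
qed

text \<open>On the plane of \<open>Omega1 (- \<epsilon>)\<close> and
  \<open>Omega3 \<epsilon>\<close> the boost acts as the hyperbolic rotation with the same
  parameter. Its light-like directions are eigendirections, with eigenvalue cosh f + mu sinh
  f.\<close>

lemma Omega0_boost:
  assumes "\<epsilon> \<in> {1, - 1}" "\<mu> \<in> {1, - 1}"
  shows "Omega0 \<epsilon> \<mu> (boost f) = (\<lambda>p. exp (\<mu> * f p) *\<^sub>R Omega0 \<epsilon> \<mu> e p)"
proof
  fix p
  have "exp (\<mu> * f p) = cosh (f p) + \<mu> * sinh (f p)"
    using assms(2) cosh_plus_sinh[of "f p"] cosh_minus_sinh[of "f p"] by auto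
  moreover have "Omega0 \<epsilon> \<mu> (boost f) p = (cosh (f p) + \<mu> * sinh (f p)) *\<^sub>R Omega0 \<epsilon> \<mu> e p"
    using assms by (elim insertE emptyE) (simp_all add: Omega0_def Omega1_def Omega3_def boost_simps
        bwedge_simps bwedge_self bwedge_e_swap algebra_simps)
  ultimately show "Omega0 \<epsilon> \<mu> (boost f) p = exp (\<mu> * f p) *\<^sub>R Omega0 \<epsilon> \<mu> e p"
    by simp
qed

text \<open>Differentiating the factor exp(mu f) contributes mu df, which cancels the -mu df of
  \<open>nabla_Omega0\<close>.\<close>

lemma nabla_Omega0_boost:
  assumes "\<epsilon> \<in> {1, - 1}" "condition_b \<epsilon> \<omega> f g \<mu>"
  shows "nabla (Omega0 \<epsilon> \<mu> (boost f)) p v = 0"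
proof -
  have f: "smooth f" and \<mu>: "\<mu> \<in> {1, - 1}"
    using assms(2) by (auto simp: condition_b_def)
  define \<phi> where "\<phi> q = exp (\<mu> * f q)" for q
  have "smooth \<phi>" unfolding \<phi>_def[abs_def] by (intro smooth_intros f)
  moreover have "smooth (Omega0 \<epsilon> \<mu> e)"
    unfolding Omega0_def[abs_def] by (intro smooth_intros smooth_Omega)
  moreover have "d0 \<phi> p v = \<mu> * d0 f p v * \<phi> p"
  proof -
    have "(\<phi> has_derivative (\<lambda>v. \<mu> * d0 f p v * \<phi> p)) (at p)"
      unfolding \<phi>_def[abs_def] d0_def
      by (rule derivative_eq_intros smooth_has_derivative f refl)+ (simp add: algebra_simps)
    from frechet_derivative_eqI[OF this] show ?thesis by (simp add: d0_def)
  qed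
  ultimately show ?thesis
    unfolding Omega0_boost[OF assms(1) \<mu>] \<phi>_def[symmetric]
    by (simp add: nabla_scaleR smooth_differentiable nabla_Omega0[OF assms] algebra_simps)
qed

end

theorem corollary9p2:
  fixes e :: frame and \<omega> :: "4 \<Rightarrow> 4 \<Rightarrow> form1" and \<epsilon> :: real
  assumes "oriented_frame_field e"
    and "connection_form e \<omega>"
    and "\<epsilon> \<in> {1, - 1}"
  shows "(fully_light_like (Omega2 \<epsilon> e) \<longleftrightarrow> (\<exists>f g \<mu>. condition_b \<epsilon> \<omega> f g \<mu>)) \<and>
    (\<forall>f g \<mu>. condition_b \<epsilon> \<omega> f g \<mu> \<longrightarrow>
       (\<forall>p v. nabla (Omega2 \<epsilon> e) p v = alpha \<mu> f g p v *\<^sub>R Omega0 \<epsilon> \<mu> e p) \<and>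
       (\<exists>e'. oriented_frame_field e' \<and> Omega2 \<epsilon> e' = Omega2 \<epsilon> e \<and>
             (\<forall>p v. nabla (Omega0 \<epsilon> \<mu> e') p v = 0)))"
proof -
  interpret moving_frame e \<omega>
    using assms(1,2) by unfold_locales
  \<comment> \<open>This covers every solution f, g, mu of (b), not just the one constructed from
    (a); the boost uses the f of the given solution.\<close>
  have "\<exists>e'. oriented_frame_field e' \<and> Omega2 \<epsilon> e' = Omega2 \<epsilon> e \<and>
      (\<forall>p v. nabla (Omega0 \<epsilon> \<mu> e') p v = 0)" if "condition_b \<epsilon> \<omega> f g \<mu>" for f g \<mu>
  proof (intro exI conjI allI)
    show "oriented_frame_field (boost f)"
      using that by (intro oriented_frame_field_boost) (simp add: condition_b_def)
    show "Omega2 \<epsilon> (boost f) = Omega2 \<epsilon> e"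
      by (rule Omega2_boost)
    show "nabla (Omega0 \<epsilon> \<mu> (boost f)) p v = 0" for p v
      by (rule nabla_Omega0_boost[OF assms(3) that])
  qed
  then show ?thesis
    using fully_light_like_imp_condition_b[OF assms(3)] condition_b_imp_fully_light_like[OF assms(3)]
      nabla_Omega2_eq_alpha[OF assms(3)]
    by blast
qed

end
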